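(* Let $\mathbb{F}$ be a field of characteristic zero and $X=\{x_1,\ldots,x_n\}$. Let $f\in\mathbb{F}\langle X,X^{-1}\rangle$ be a nonzero expression of degree $D$ and sparsity $s$. Then $f$ is not an identity for the matrix algebra $\mathbb{M}_k(\mathbb{F})$ for some $k=O(\log s)$. That is, there exist invertible matrices $a_1,\ldots,a_n\in\mathbb{M}_k(\mathbb{F})$ with $f(a_1,\ldots,a_n)\neq 0$.
   Context: $\mathbb{F}\langle X,X^{-1}\rangle$ is the free group algebra over $\mathbb{F}$ on the free group generated by $x_1,\ldots,x_n$. Its elements are finite $\mathbb{F}$-linear combinations $f=\sum_w\alpha_w w$ of reduced words over $\{x_1^{\pm1},\ldots,x_n^{\pm1}\}$, i.e. words with no adjacent $x_ix_i^{-1}$ or $x_i^{-1}x_i$. The degree of $f$ is the maximum length of a reduced word $w$ with $\alpha_w\neq0$. The sparsity of $f$ is the number of reduced words $w$ with $\alpha_w\neq0$. For an associative $\mathbb{F}$-algebra $A$ with identity, $f$ is an identity for $A$ if $f(a_1,\ldots,a_n)=0$ for all $a_1,\ldots,a_n\in A$ such that each $a_i^{-1}$ exists. Here $f(a_1,\ldots,a_n)$ is obtained by substituting $a_i$ for $x_i$ and $a_i^{-1}$ for $x_i^{-1}$. *)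

theory Defs
  imports
    "Jordan_Normal_Form.Matrix"
    "HOL-Algebra.Module"
    "HOL-Library.Poly_Mapping"
    "HOL-Library.Landau_Symbols"
begin

text \<open>
  The letter \<open>(i, True)\<close> is $x_{i+1}$ and \<open>(i, False)\<close> is its inverse, for \<open>i < n\<close>.
\<close>

type_synonym letter = "nat \<times> bool"

definition reduced :: "letter list \<Rightarrow> bool" where
  "reduced w \<longleftrightarrow>
    (\<forall>j. Suc j < length w \<longrightarrow> \<not> (fst (w ! j) = fst (w ! Suc j) \<and> snd (w ! j) \<noteq> snd (w ! Suc j)))"

definition reduced_words :: "nat \<Rightarrow> letter list set" where
  "reduced_words n = {w. reduced w \<and> fst ` set w \<subseteq> {..<n}}"

text \<open>
  Every element of the free group has exactly one reduced word, so the elements of the free group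
  algebra are the finitely supported coefficient functions on reduced words;
  \<open>Poly_Mapping.keys f\<close> is the set of words with nonzero coefficient. The product of the
  algebra plays no role below.
\<close>

definition free_group_algebra :: "nat \<Rightarrow> (letter list \<Rightarrow>\<^sub>0 'a::field) set" where
  "free_group_algebra n = {f. Poly_Mapping.keys f \<subseteq> reduced_words n}"

text \<open>The degree is only meaningful for \<open>f \<noteq> 0\<close>, since \<open>Max {}\<close> is unspecified.\<close>

definition fga_degree :: "(letter list \<Rightarrow>\<^sub>0 'a::field) \<Rightarrow> nat" where
  "fga_degree f = Max (length ` Poly_Mapping.keys f)"

definition sparsity :: "(letter list \<Rightarrow>\<^sub>0 'a::field) \<Rightarrow> nat" where
  "sparsity f = card (Poly_Mapping.keys f)"

text \<open>
  An associative algebra over the field is given by a record of type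
  \<^typ>\<open>('a, 'b) module\<close>, whose fields include a ring multiplication and unit as well as
  the scalar multiplication. The locale \<open>algebra\<close> of the library is not used because it requires a
  commutative multiplication.
\<close>

definition letter_eval ::
  "('a::field, 'b) module \<Rightarrow> (nat \<Rightarrow> 'b) \<Rightarrow> letter \<Rightarrow> 'b" where
  "letter_eval A a l = (if snd l then a (fst l) else inv\<^bsub>A\<^esub> (a (fst l)))"

definition word_eval ::
  "('a::field, 'b) module \<Rightarrow> (nat \<Rightarrow> 'b) \<Rightarrow> letter list \<Rightarrow> 'b" where
  "word_eval A a w = foldr (\<lambda>l b. letter_eval A a l \<otimes>\<^bsub>A\<^esub> b) w \<one>\<^bsub>A\<^esub>"

definition fga_eval ::
  "('a::field, 'b) module \<Rightarrow> (nat \<Rightarrow> 'b) \<Rightarrow> (letter list \<Rightarrow>\<^sub>0 'a) \<Rightarrow> 'b" where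
  "fga_eval A a f =
    (\<Oplus>\<^bsub>A\<^esub>w\<in>Poly_Mapping.keys f. Poly_Mapping.lookup f w \<odot>\<^bsub>A\<^esub> word_eval A a w)"

definition is_identity ::
  "nat \<Rightarrow> (letter list \<Rightarrow>\<^sub>0 'a::field) \<Rightarrow> ('a, 'b) module \<Rightarrow> bool" where
  "is_identity n f A \<longleftrightarrow>
    (\<forall>a. (\<forall>i<n. a i \<in> Units A) \<longrightarrow> fga_eval A a f = \<zero>\<^bsub>A\<^esub>)"

abbreviation matrix_algebra :: "'a::field itself \<Rightarrow> nat \<Rightarrow> ('a, 'a mat) module" where
  "matrix_algebra F k \<equiv> module_mat F k k"

end

theory Submission
  imports
    Defs
    "Jordan_Normal_Form.Determinant"
    "HOL-Library.Log_Nat"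
begin

text \<open>
  Only the words of maximal length are used. If matrices satisfy
  \<open>A\<^sub>x = t P\<^sub>x + O(1/t)\<close> and \<open>A\<^sub>x\<inverse> = t P\<^sub>x\<^sub>' + O(1/t)\<close>, where \<open>x'\<close> is the
  inverse letter, then the coefficient of \<open>t^D\<close> in \<open>f(A)\<close> is the sum of \<open>\<alpha>\<^sub>w P\<^sub>w\<close> over the
  words \<open>w\<close> of length \<open>D\<close>, so it suffices that this sum is nonzero. The choice
  \<open>A\<^sub>x = \<pi>\<^sub>x \<otimes> t N\<^sub>x + \<pi>\<^sub>x\<^sub>' \<otimes> N\<^sub>x\<^sub>'\<inverse> / t\<close>, with complementary rank one projections
  \<open>\<pi>\<^sub>x\<close>, \<open>\<pi>\<^sub>x\<^sub>'\<close> of the plane onto lines that are distinct for distinct letters, works for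
  arbitrary invertible \<open>N\<close>; on reduced words the projections contribute only nonzero scalars.
  This reduces the claim to a homogeneous polynomial in the free monoid on all letters.

  There, induct on the degree. If all words start with the same letter, strip it. Otherwise some first
  letter \<open>a\<close> occurs in at most half of the words, and adding to the matrices one state that is left
  only by reading \<open>a\<close> isolates these words; so one more dimension is paid for halving the sparsity.

  In both steps the parameter is introduced by a polynomial deformation of a degenerate situation,
  where the value at zero is nonzero, hence also the value at some nonzero point.
\<close>

section \<open>Matrix products along words\<close>

definition wprod :: "nat \<Rightarrow> ('l \<Rightarrow> 'a::semiring_1 mat) \<Rightarrow> 'l list \<Rightarrow> 'a mat" where
  "wprod k M w = foldr (\<lambda>l B. M l * B) w (1\<^sub>m k)"

lemma wprod_simps [simp]:
  "wprod k M [] = 1\<^sub>m k"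
  "wprod k M (l # w) = M l * wprod k M w"
  by (simp_all add: wprod_def)

lemma wprod_carrier [simp]:
  assumes "\<And>l. M l \<in> carrier_mat k k"
  shows "wprod k M w \<in> carrier_mat k k"
  using assms by (induction w) (auto intro: mult_carrier_mat)

lemma wprod_smult:
  fixes M :: "'l \<Rightarrow> 'a::comm_semiring_1 mat"
  assumes "\<And>l. M l \<in> carrier_mat k k"
  shows "wprod k (\<lambda>l. c \<cdot>\<^sub>m M l) w = c ^ length w \<cdot>\<^sub>m wprod k M w"
proof (induction w)
  case Nil
  then show ?case by (intro eq_matI) auto
next
  case (Cons l w)
  have "wprod k M w \<in> carrier_mat k k" "M l \<in> carrier_mat k k"
    using assms by auto
  with Cons show ?case
    by (intro eq_matI) (auto simp: scalar_prod_def sum_distrib_left mult_ac)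
qed

section \<open>Polynomial functions of a scalar parameter\<close>

text \<open>Working with functions instead of formal polynomials keeps all matrices over the field;
  polynomiality is then checked entry by entry.\<close>

definition polyfun :: "('a::comm_ring_1 \<Rightarrow> 'a) \<Rightarrow> bool" where
  "polyfun \<phi> \<longleftrightarrow> (\<exists>p. \<forall>u. \<phi> u = poly p u)"

lemma polyfun_const [intro]: "polyfun (\<lambda>u. c)"
  unfolding polyfun_def by (rule exI[of _ "[:c:]"]) simp

lemma polyfun_id [intro]: "polyfun (\<lambda>u. u)"
  unfolding polyfun_def by (rule exI[of _ "[:0, 1:]"]) simp

lemma polyfun_add [intro]: "polyfun \<phi> \<Longrightarrow> polyfun \<psi> \<Longrightarrow> polyfun (\<lambda>u. \<phi> u + \<psi> u)"
  unfolding polyfun_def by (metis poly_add)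

lemma polyfun_mult [intro]: "polyfun \<phi> \<Longrightarrow> polyfun \<psi> \<Longrightarrow> polyfun (\<lambda>u. \<phi> u * \<psi> u)"
  unfolding polyfun_def by (metis poly_mult)

lemma polyfun_power [intro]: "polyfun \<phi> \<Longrightarrow> polyfun (\<lambda>u. \<phi> u ^ n)"
  by (induction n) auto

lemma polyfun_sum [intro]:
  "(\<And>x. x \<in> A \<Longrightarrow> polyfun (\<phi> x)) \<Longrightarrow> polyfun (\<lambda>u. \<Sum>x\<in>A. \<phi> x u)"
  by (induction A rule: infinite_finite_induct) auto

text \<open>A nonzero polynomial has finitely many roots, while a field of characteristic zero is
  infinite. The parameter \<open>0\<close> is to be avoided because the deformed matrices become
  singular there.\<close>

lemma polyfun_nonzero_shift:
  fixes \<phi> :: "'a::field_char_0 \<Rightarrow> 'a"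
  assumes "polyfun \<phi>" "\<phi> 0 \<noteq> 0"
  obtains u where "u \<noteq> 0" "\<phi> u \<noteq> 0"
proof -
  obtain p where p: "\<And>u. \<phi> u = poly p u"
    using assms(1) unfolding polyfun_def by blast
  with assms(2) have "p \<noteq> 0" by auto
  then have "finite (insert 0 {u. poly p u = 0})"
    by (simp add: poly_roots_finite)
  then obtain u where "u \<notin> insert 0 {u. poly p u = 0}"
    using ex_new_if_finite infinite_UNIV_char_0 by blast
  with that p show thesis by auto
qed

lemma polyfun_wprod:
  assumes "\<And>l u. M u l \<in> carrier_mat k k"
    and "\<And>l i j. i < k \<Longrightarrow> j < k \<Longrightarrow> polyfun (\<lambda>u. M u l $$ (i, j))"
    and "i < k" "j < k"
  shows "polyfun (\<lambda>u. wprod k (M u) w $$ (i, j))"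
  using assms(3)
proof (induction w arbitrary: i)
  case Nil
  with assms(4) show ?case by auto
next
  case (Cons l w)
  have "wprod k (M u) (l # w) $$ (i, j) = (\<Sum>r<k. M u l $$ (i, r) * wprod k (M u) w $$ (r, j))" for u
  proof -
    have "M u l \<in> carrier_mat k k" "wprod k (M u) w \<in> carrier_mat k k"
      using assms(1) by auto
    then show ?thesis
      using Cons.prems assms(4) by (auto simp: scalar_prod_def atLeast0LessThan)
  qed
  then show ?case
    using Cons assms(2) by (auto intro!: polyfun_sum polyfun_mult)
qed

lemma det_nonzero_inverse:
  fixes A :: "'a::field mat"
  assumes "A \<in> carrier_mat k k" "det A \<noteq> 0"
  shows "\<exists>B. B \<in> carrier_mat k k \<and> A * B = 1\<^sub>m k \<and> B * A = 1\<^sub>m k"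
  using det_non_zero_imp_unit[OF assms, of undefined]
  by (auto simp: Units_def ring_mat_def)

section \<open>Adding one state to a family of matrices\<close>

text \<open>Here \<open>\<xi>\<close> is the weight of staying in the new state, which is left by reading the letter \<open>a\<close>.\<close>

definition branch_mat :: "nat \<Rightarrow> nat \<Rightarrow> 'l \<Rightarrow> ('l \<Rightarrow> 'a::field mat) \<Rightarrow> 'a \<Rightarrow> 'l \<Rightarrow> 'a mat" where
  "branch_mat k i a N \<xi> l =
    four_block_mat (\<xi> \<cdot>\<^sub>m 1\<^sub>m 1) (mat 1 k (\<lambda>(_, j). if l = a \<and> j = i then 1 else 0)) (0\<^sub>m k 1) (N l)"

lemma branch_mat_carrier:
  "N l \<in> carrier_mat k k \<Longrightarrow> branch_mat k i a N \<xi> l \<in> carrier_mat (Suc k) (Suc k)"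
  unfolding branch_mat_def by (metis four_block_carrier_mat one_carrier_mat plus_1_eq_Suc smult_carrier_mat)

lemma det_branch_mat:
  "N l \<in> carrier_mat k k \<Longrightarrow> det (branch_mat k i a N \<xi> l) = \<xi> * det (N l)"
  unfolding branch_mat_def
  by (subst det_four_block_mat_lower_left_zero_col[where n = k]) (auto simp: det_smult)

lemma polyfun_branch_mat:
  assumes "N l \<in> carrier_mat k k" "r < Suc k" "c < Suc k"
  shows "polyfun (\<lambda>\<xi>. branch_mat k i a N \<xi> l $$ (r, c))"
  using assms unfolding branch_mat_def by (cases "r = 0"; cases "c = 0") auto

text \<open>Block upper triangular matrices are closed under products and their diagonal blocks
  multiply separately. The corner \<open>R\<close> stays unspecified here; its entries for weight
  \<open>0\<close> are computed next.\<close>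

lemma wprod_branch_mat:
  assumes N: "\<And>l. N l \<in> carrier_mat k k"
  shows "\<exists>R \<in> carrier_mat 1 k. wprod (Suc k) (branch_mat k i a N \<xi>) w =
    four_block_mat (\<xi> ^ length w \<cdot>\<^sub>m 1\<^sub>m 1) R (0\<^sub>m k 1) (wprod k N w)"
proof (induction w)
  case Nil
  show ?case
    by (rule bexI[of _ "0\<^sub>m 1 k"]) (auto intro!: eq_matI)
next
  case (Cons l w)
  then obtain R where R: "R \<in> carrier_mat 1 k"
    "wprod (Suc k) (branch_mat k i a N \<xi>) w =
      four_block_mat (\<xi> ^ length w \<cdot>\<^sub>m 1\<^sub>m 1) R (0\<^sub>m k 1) (wprod k N w)"
    by auto
  let ?E = "mat 1 k (\<lambda>(_, j). if l = a \<and> j = i then 1 else 0) :: 'b mat"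
  have V: "wprod k N w \<in> carrier_mat k k" using N by simp
  have E: "?E \<in> carrier_mat 1 k" by simp
  have one: "\<And>x. x \<cdot>\<^sub>m 1\<^sub>m 1 \<in> carrier_mat 1 1" by simp
  have "wprod (Suc k) (branch_mat k i a N \<xi>) (l # w) = four_block_mat
    ((\<xi> \<cdot>\<^sub>m 1\<^sub>m 1) * (\<xi> ^ length w \<cdot>\<^sub>m 1\<^sub>m 1) + ?E * 0\<^sub>m k 1)
    ((\<xi> \<cdot>\<^sub>m 1\<^sub>m 1) * R + ?E * wprod k N w)
    (0\<^sub>m k 1 * (\<xi> ^ length w \<cdot>\<^sub>m 1\<^sub>m 1) + N l * 0\<^sub>m k 1)
    (0\<^sub>m k 1 * R + N l * wprod k N w)"
    unfolding wprod_simps R(2) branch_mat_def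
    by (rule mult_four_block_mat[OF one E zero_carrier_mat N one R(1) zero_carrier_mat V])
  also have "(\<xi> \<cdot>\<^sub>m 1\<^sub>m 1) * (\<xi> ^ length w \<cdot>\<^sub>m 1\<^sub>m 1) + ?E * 0\<^sub>m k 1 = \<xi> ^ length (l # w) \<cdot>\<^sub>m 1\<^sub>m 1"
    by (intro eq_matI) (auto simp: scalar_prod_def)
  also have "0\<^sub>m k 1 * (\<xi> ^ length w \<cdot>\<^sub>m 1\<^sub>m 1) + N l * 0\<^sub>m k 1 = 0\<^sub>m k 1"
    using N[of l] by (intro eq_matI) auto
  also have "0\<^sub>m k 1 * R + N l * wprod k N w = wprod k N (l # w)"
    using N[of l] V R(1) by (intro eq_matI) auto
  finally show ?case
    using R(1) V by (intro bexI[of _ "(\<xi> \<cdot>\<^sub>m 1\<^sub>m 1) * R + ?E * wprod k N w"]) auto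
qed

text \<open>With weight \<open>0\<close> the new state has to be left at the first letter, which
  only \<open>a\<close> permits and which leads to the old state \<open>i\<close>. The remaining
  word is then read by \<open>N\<close> from \<open>i\<close> to \<open>j\<close>; old states are
  shifted by one.\<close>

lemma wprod_branch_mat_zero:
  assumes N: "\<And>l. N l \<in> carrier_mat k k" and ij: "i < k" "j < k"
  shows "wprod (Suc k) (branch_mat k i a N 0) (l # w) $$ (0, Suc j) =
    (if l = a then wprod k N w $$ (i, j) else 0)"
proof -
  obtain R where R: "R \<in> carrier_mat 1 k"
    "wprod (Suc k) (branch_mat k i a N 0) w =
      four_block_mat (0 ^ length w \<cdot>\<^sub>m 1\<^sub>m 1) R (0\<^sub>m k 1) (wprod k N w)"
    using wprod_branch_mat[of N k i a 0 w] N by auto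
  have V: "wprod k N w \<in> carrier_mat k k" using N by simp
  have C: "branch_mat k i a N 0 l \<in> carrier_mat (Suc k) (Suc k)"
    by (intro branch_mat_carrier N)
  have "wprod (Suc k) (branch_mat k i a N 0) (l # w) $$ (0, Suc j) =
    (\<Sum>r<Suc k. branch_mat k i a N 0 l $$ (0, r) *
       four_block_mat (0 ^ length w \<cdot>\<^sub>m 1\<^sub>m 1) R (0\<^sub>m k 1) (wprod k N w) $$ (r, Suc j))"
    using C V R ij by (simp add: scalar_prod_def atLeast0LessThan)
  \<comment> \<open>The term for the new state carries the staying weight \<open>0\<close>, so only
    the old states remain in the sum.\<close>
  also have "\<dots> = (\<Sum>r<k. (if l = a \<and> r = i then 1 else 0) * wprod k N w $$ (r, j))"
    using V R ij N[of l] by (simp add: sum.lessThan_Suc_shift branch_mat_def del: sum.lessThan_Suc)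
  also have "\<dots> = (\<Sum>r<k. if r = i then (if l = a then wprod k N w $$ (i, j) else 0) else 0)"
    by (intro sum.cong) auto
  finally show ?thesis using ij by simp
qed

section \<open>Homogeneous polynomials in the free monoid\<close>

text \<open>Invertibility is part of the notion because stripping a common first letter cancels its
  matrix and because the group letters are later built from the inverses.\<close>

definition detects :: "nat \<Rightarrow> ('l \<Rightarrow> 'a::field mat) \<Rightarrow> 'l list set \<Rightarrow> ('l list \<Rightarrow> 'a) \<Rightarrow> bool" where
  "detects m N W \<beta> \<longleftrightarrow>
    (\<forall>l. N l \<in> carrier_mat m m \<and> det (N l) \<noteq> 0) \<and>
    (\<exists>i<m. \<exists>j<m. (\<Sum>w\<in>W. \<beta> w * wprod m N w $$ (i, j)) \<noteq> 0)"

text \<open>The common first letter contributes the invertible left factor \<open>N a\<close>, which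
  cannot annihilate a nonzero matrix.\<close>

lemma detects_Cons:
  assumes "detects m N {v. a # v \<in> W} (\<lambda>v. \<beta> (a # v))" "\<And>w. w \<in> W \<Longrightarrow> w \<noteq> [] \<and> hd w = a"
  shows "detects m N W \<beta>"
proof -
  let ?V = "{v. a # v \<in> W}"
  have W: "W = (#) a ` ?V"
    using assms(2) by (force simp: image_iff neq_Nil_conv)
  have N: "\<And>l. N l \<in> carrier_mat m m" "\<And>l. det (N l) \<noteq> 0"
    using assms(1) by (auto simp: detects_def)
  \<comment> \<open>\<open>H\<close> is the matrix value of the stripped polynomial, so
    \<open>N a * H\<close> is that of the original one.\<close>
  define H where "H = mat m m (\<lambda>(i, j). \<Sum>v\<in>?V. \<beta> (a # v) * wprod m N v $$ (i, j))"
  obtain B where B: "B \<in> carrier_mat m m" "B * N a = 1\<^sub>m m"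
    using det_nonzero_inverse[OF N] by blast
  have H: "H \<in> carrier_mat m m" by (simp add: H_def)
  have ent: "(N a * H) $$ (i, j) = (\<Sum>w\<in>W. \<beta> w * wprod m N w $$ (i, j))" if "i < m" "j < m" for i j
  proof -
    have "(\<Sum>w\<in>W. \<beta> w * wprod m N w $$ (i, j)) = (\<Sum>v\<in>?V. \<beta> (a # v) * wprod m N (a # v) $$ (i, j))"
      by (subst W, subst sum.reindex) auto
    also have "\<dots> = (\<Sum>v\<in>?V. \<Sum>r<m. \<beta> (a # v) * (N a $$ (i, r) * wprod m N v $$ (r, j)))"
    proof (intro sum.cong refl)
      fix v
      have "N a \<in> carrier_mat m m" "wprod m N v \<in> carrier_mat m m" using N by auto
      then show "\<beta> (a # v) * wprod m N (a # v) $$ (i, j) =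
          (\<Sum>r<m. \<beta> (a # v) * (N a $$ (i, r) * wprod m N v $$ (r, j)))"
        using that by (auto simp: scalar_prod_def atLeast0LessThan sum_distrib_left)
    qed
    also have "\<dots> = (\<Sum>r<m. \<Sum>v\<in>?V. \<beta> (a # v) * (N a $$ (i, r) * wprod m N v $$ (r, j)))"
      by (rule sum.swap)
    also have "\<dots> = (N a * H) $$ (i, j)"
      using that N(1)[of a] by (auto simp: H_def scalar_prod_def atLeast0LessThan sum_distrib_left mult_ac)
    finally show ?thesis by simp
  qed
  have "\<exists>i<m. \<exists>j<m. (N a * H) $$ (i, j) \<noteq> 0"
  proof (rule ccontr)
    assume "\<not> ?thesis"
    then have "N a * H = 0\<^sub>m m m"
      using N(1)[of a] H by (intro eq_matI) auto
    then have "B * N a * H = 0\<^sub>m m m"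
      using B(1) H N(1)[of a] by (simp add: assoc_mult_mat[of _ m m _ m _ m])
    then have "H = 0\<^sub>m m m" using B(2) H by simp
    moreover obtain i j where "i < m" "j < m" "H $$ (i, j) \<noteq> 0"
      using assms(1) by (auto simp: detects_def H_def)
    ultimately show False by simp
  qed
  with ent have "\<exists>i<m. \<exists>j<m. (\<Sum>w\<in>W. \<beta> w * wprod m N w $$ (i, j)) \<noteq> 0"
    by metis
  with N show ?thesis unfolding detects_def by blast
qed

text \<open>At weight \<open>0\<close> exactly the words starting with \<open>a\<close> survive, but
  the new matrices are singular. Since the entry is polynomial in the weight, some nonzero weight
  keeps it nonzero and makes all determinants nonzero.\<close>

lemma detects_branch:
  fixes \<beta> :: "'l list \<Rightarrow> 'a::field_char_0"
  assumes "detects m N {v. a # v \<in> W} (\<lambda>v. \<beta> (a # v))" "finite W" "[] \<notin> W"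
  shows "\<exists>N'. detects (Suc m) N' W \<beta>"
proof -
  let ?V = "{v. a # v \<in> W}"
  have N: "\<And>l. N l \<in> carrier_mat m m" "\<And>l. det (N l) \<noteq> 0"
    using assms(1) by (auto simp: detects_def)
  obtain i j where ij: "i < m" "j < m" "(\<Sum>v\<in>?V. \<beta> (a # v) * wprod m N v $$ (i, j)) \<noteq> 0"
    using assms(1) by (auto simp: detects_def)
  let ?N = "branch_mat m i a N"
  define \<phi> where "\<phi> \<xi> = (\<Sum>w\<in>W. \<beta> w * wprod (Suc m) (?N \<xi>) w $$ (0, Suc j))" for \<xi>
  have "polyfun \<phi>"
    unfolding \<phi>_def using ij N
    by (intro polyfun_sum polyfun_mult polyfun_const polyfun_wprod branch_mat_carrier polyfun_branch_mat) auto
  moreover have "\<phi> 0 = (\<Sum>v\<in>?V. \<beta> (a # v) * wprod m N v $$ (i, j))"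
  proof -
    have "\<phi> 0 = (\<Sum>w\<in>W. if w \<in> (#) a ` ?V then \<beta> w * wprod m N (tl w) $$ (i, j) else 0)"
      unfolding \<phi>_def
    proof (rule sum.cong[OF refl])
      fix w assume "w \<in> W"
      moreover from this obtain l v where "w = l # v" using assms(3) by (cases w) auto
      ultimately show "\<beta> w * wprod (Suc m) (?N 0) w $$ (0, Suc j) =
          (if w \<in> (#) a ` ?V then \<beta> w * wprod m N (tl w) $$ (i, j) else 0)"
        using wprod_branch_mat_zero[of N m i j a l v, OF N(1) ij(1,2)] by (auto simp del: wprod_simps)
    qed
    also have "\<dots> = (\<Sum>w\<in>(#) a ` ?V. \<beta> w * wprod m N (tl w) $$ (i, j))"
      using assms(2) by (subst sum.inter_restrict[symmetric]) (auto intro!: sum.cong)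
    also have "\<dots> = (\<Sum>v\<in>?V. \<beta> (a # v) * wprod m N v $$ (i, j))"
      by (subst sum.reindex) auto
    finally show ?thesis .
  qed
  ultimately obtain \<xi> where "\<xi> \<noteq> 0" "\<phi> \<xi> \<noteq> 0"
    using polyfun_nonzero_shift ij(3) by metis
  moreover have "\<forall>l. ?N \<xi> l \<in> carrier_mat (Suc m) (Suc m) \<and> det (?N \<xi> l) = \<xi> * det (N l)"
    using N branch_mat_carrier det_branch_mat by metis
  ultimately have "detects (Suc m) (?N \<xi>) W \<beta>"
    unfolding detects_def \<phi>_def using N(2) ij(2)
    by (intro conjI exI[of _ 0] exI[of _ "Suc j"]) simp_all
  then show ?thesis by blast
qed

text \<open>Words with different first letters form disjoint subsets of \<open>W\<close>, so the
  smaller of two such subsets has at most half of the elements.\<close>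

lemma minority_letter:
  assumes "finite W" "u \<in> W" "v \<in> W" "u \<noteq> []" "v \<noteq> []" "hd u \<noteq> hd v"
  obtains a where "{v. a # v \<in> W} \<noteq> {}" "2 * card {v. a # v \<in> W} \<le> card W"
proof -
  let ?V = "\<lambda>a. {v. a # v \<in> W}"
  have fin: "finite (?V a)" for a
    by (rule finite_vimageI[OF assms(1), of "(#) a", unfolded vimage_def]) auto
  have card: "card ((#) a ` ?V a) = card (?V a)" for a
    by (rule card_image) auto
  have "card ((#) (hd u) ` ?V (hd u)) + card ((#) (hd v) ` ?V (hd v)) =
      card ((#) (hd u) ` ?V (hd u) \<union> (#) (hd v) ` ?V (hd v))"
    using assms(6) fin by (intro card_Un_disjoint[symmetric]) auto
  also have "\<dots> \<le> card W"
    using assms(1) by (intro card_mono) auto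
  finally have "card (?V (hd u)) + card (?V (hd v)) \<le> card W"
    by (simp add: card)
  moreover have "tl u \<in> ?V (hd u)" "tl v \<in> ?V (hd v)"
    using assms by auto
  ultimately show thesis
    using that[of "hd u"] that[of "hd v"] by (cases "card (?V (hd u)) \<le> card (?V (hd v))") auto
qed

text \<open>Induction on the common length: branching costs one dimension and halves the number of
  words, stripping costs nothing.\<close>

lemma detects_exists:
  fixes \<beta> :: "'l list \<Rightarrow> 'a::field_char_0"
  assumes "finite W" "W \<noteq> {}" "\<And>w. w \<in> W \<Longrightarrow> length w = D" "\<And>w. w \<in> W \<Longrightarrow> \<beta> w \<noteq> 0" "card W < 2 ^ m"
  shows "\<exists>N. detects m N W \<beta>"
  using assms
proof (induction D arbitrary: W \<beta> m)
  case 0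
  then have W: "W = {[]}" by auto
  \<comment> \<open>Since \<open>card W = 1\<close>, the strict bound excludes dimension
    \<open>0\<close>, so the entry \<open>(0, 0)\<close> of the identity exists.\<close>
  with 0 have "0 < m" by (cases m) auto
  with W 0 show ?case
    by (auto simp: detects_def intro!: exI[of _ "\<lambda>_. 1\<^sub>m m"] exI[of _ 0])
next
  case (Suc D)
  have nonempty: "w \<noteq> []" if "w \<in> W" for w using Suc.prems(3) that by force
  have fin: "finite {v. a # v \<in> W}" for a
    by (rule finite_vimageI[OF Suc.prems(1), of "(#) a", unfolded vimage_def]) auto
  have IH: "\<exists>N. detects m' N {v. a # v \<in> W} (\<lambda>v. \<beta> (a # v))"
    if "{v. a # v \<in> W} \<noteq> {}" "card {v. a # v \<in> W} < 2 ^ m'" for a m'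
  proof (rule Suc.IH[OF fin that(1) _ _ that(2)])
    show "length v = D" if "v \<in> {v. a # v \<in> W}" for v
      using that Suc.prems(3) by fastforce
    show "\<beta> (a # v) \<noteq> 0" if "v \<in> {v. a # v \<in> W}" for v
      using that Suc.prems(4) by simp
  qed
  show ?case
  proof (cases "\<exists>u\<in>W. \<exists>v\<in>W. hd u \<noteq> hd v")
    case True
    then obtain a where a: "{v. a # v \<in> W} \<noteq> {}" "2 * card {v. a # v \<in> W} \<le> card W"
      using minority_letter Suc.prems(1) nonempty by metis
    \<comment> \<open>Both a chosen word and the bound by half give \<open>card W \<ge> 2\<close>,
      hence a dimension is left to spend.\<close>
    obtain m' where m: "m = Suc m'"
      using a Suc.prems(5) fin[of a] by (cases m) auto
    have "card {v. a # v \<in> W} < 2 ^ m'"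
      using a(2) Suc.prems(5) m by simp
    then obtain N where "detects m' N {v. a # v \<in> W} (\<lambda>v. \<beta> (a # v))"
      using IH[OF a(1)] by blast
    then show ?thesis
      using detects_branch[of m' N a W \<beta>] Suc.prems(1) nonempty m by blast
  next
    case False
    obtain u where u: "u \<in> W" using Suc.prems(2) by blast
    let ?V = "{v. hd u # v \<in> W}"
    have "tl u \<in> ?V" using u nonempty by auto
    moreover have "card ?V = card ((#) (hd u) ` ?V)"
      by (rule card_image[symmetric]) auto
    moreover have "\<dots> \<le> card W"
      using Suc.prems(1) by (intro card_mono) auto
    ultimately obtain N where "detects m N ?V (\<lambda>v. \<beta> (hd u # v))"
      using IH[of "hd u" m] Suc.prems(5) by fastforce
    then show ?thesis
      using detects_Cons[of m N "hd u" W \<beta>] False u nonempty by blast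
  qed
qed

section \<open>Letters, reduced words and slopes\<close>

definition flip :: "letter \<Rightarrow> letter" where
  "flip l = (fst l, \<not> snd l)"

lemma flip_flip [simp]: "flip (flip l) = l"
  by (simp add: flip_def)

lemma flip_neq [simp]: "flip l \<noteq> l" "l \<noteq> flip l"
  by (cases l; simp add: flip_def)+

lemma reduced_Cons: "reduced (l # w) \<longleftrightarrow> reduced w \<and> (w \<noteq> [] \<longrightarrow> hd w \<noteq> flip l)"
proof -
  \<comment> \<open>Position \<open>0\<close> is the junction of \<open>l\<close> with
    \<open>w\<close>; the positions \<open>Suc j\<close> are those inside \<open>w\<close>.\<close>
  have all: "(\<forall>j. P j) \<longleftrightarrow> P 0 \<and> (\<forall>j. P (Suc j))" for P :: "nat \<Rightarrow> bool"
    by (metis not0_implies_Suc)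
  show ?thesis
    unfolding reduced_def by (subst all) (auto simp: hd_conv_nth flip_def prod_eq_iff)
qed

text \<open>Letters are numbered by positive integers, odd for generators and even for inverses.
  Characteristic zero keeps these scalars distinct and different from \<open>0\<close>.\<close>

definition slope :: "letter \<Rightarrow> 'a::field_char_0" where
  "slope l = of_nat (2 * fst l + (if snd l then 1 else 2))"

lemma slope_nonzero [simp]: "slope l \<noteq> 0"
  unfolding slope_def by (metis add_is_0 of_nat_eq_0_iff one_neq_zero zero_neq_numeral)

lemma slope_eq_iff [simp]: "slope l = slope l' \<longleftrightarrow> l = l'"
proof -
  have "2 * fst l + (if snd l then 1 else 2) = 2 * fst l' + (if snd l' then 1 else 2) \<longleftrightarrow> l = l'"
    by (cases l; cases l') (auto; presburger)
  then show ?thesis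
    unfolding slope_def of_nat_eq_iff .
qed

section \<open>Block matrices and rank one projections of the plane\<close>

text \<open>This is the Kronecker product of the two by two matrix with rows \<open>(a, b)\<close>
  and \<open>(c, d)\<close> with \<open>B\<close>.\<close>

definition blk :: "'a \<Rightarrow> 'a \<Rightarrow> 'a \<Rightarrow> 'a \<Rightarrow> 'a::field mat \<Rightarrow> 'a mat" where
  "blk a b c d B = four_block_mat (a \<cdot>\<^sub>m B) (b \<cdot>\<^sub>m B) (c \<cdot>\<^sub>m B) (d \<cdot>\<^sub>m B)"

lemma blk_carrier [simp]: "B \<in> carrier_mat m m \<Longrightarrow> blk a b c d B \<in> carrier_mat (2 * m) (2 * m)"
  unfolding blk_def mult_2 by (rule four_block_carrier_mat) auto

lemma blk_mult:
  assumes "B \<in> carrier_mat m m" "B' \<in> carrier_mat m m"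
  shows "blk a b c d B * blk a' b' c' d' B' =
    blk (a * a' + b * c') (a * b' + b * d') (c * a' + d * c') (c * b' + d * d') (B * B')"
proof -
  have sm: "(x \<cdot>\<^sub>m B) * (y \<cdot>\<^sub>m B') = (x * y) \<cdot>\<^sub>m (B * B')" for x y
    using assms by (intro eq_matI) (auto simp: scalar_prod_def sum_distrib_left mult_ac)
  have c: "x \<cdot>\<^sub>m B \<in> carrier_mat m m" "x \<cdot>\<^sub>m B' \<in> carrier_mat m m" for x
    using assms by auto
  show ?thesis
    unfolding blk_def
    by (subst mult_four_block_mat[OF c(1) c(1) c(1) c(1) c(2) c(2) c(2) c(2)])
       (simp add: sm add_smult_distrib_right_mat[OF mult_carrier_mat[OF assms]])
qed

lemma blk_cong:
  "\<lbrakk>a = a'; b = b'; c = c'; d = d'\<rbrakk> \<Longrightarrow> blk a b c d B = blk a' b' c' d' B"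
  by simp

lemma blk_zero: "B \<in> carrier_mat m m \<Longrightarrow> blk 0 0 0 0 B = 0\<^sub>m (2 * m) (2 * m)"
  by (intro eq_matI) (auto simp: blk_def)

lemma polyfun_blk:
  assumes "B \<in> carrier_mat m m" "B' \<in> carrier_mat m m" "i < 2 * m" "j < 2 * m"
  shows "polyfun (\<lambda>u. (blk a b c d B + blk a' b' c' d' (u\<^sup>2 \<cdot>\<^sub>m B')) $$ (i, j))"
  using assms unfolding blk_def
  by (cases "i < m"; cases "j < m") (auto intro!: polyfun_add polyfun_mult polyfun_power)

text \<open>\<open>(1, z)\<^sup>T (z', -1) / (z' - z)\<close> with \<open>z = slope l\<close>, \<open>z' = slope (flip l)\<close> is the projection
  onto the line of slope \<open>z\<close> along the line of slope \<open>z'\<close>.\<close>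

definition proj :: "letter \<Rightarrow> 'a::field_char_0 mat \<Rightarrow> 'a mat" where
  "proj l B = (let z = slope l; z' = slope (flip l); d = z' - z
    in blk (z' / d) (- 1 / d) (z * z' / d) (- z / d) B)"

lemma proj_carrier [simp]: "B \<in> carrier_mat m m \<Longrightarrow> proj l B \<in> carrier_mat (2 * m) (2 * m)"
  by (simp add: proj_def Let_def)

lemma proj_mult:
  assumes "B \<in> carrier_mat m m" "B' \<in> carrier_mat m m"
  shows "proj l B * proj l B' = proj l (B * B')" "proj l B * proj (flip l) B' = 0\<^sub>m (2 * m) (2 * m)"
proof -
  define z z' :: 'a where "z = slope l" and "z' = slope (flip l)"
  have d: "z' - z \<noteq> 0" "z - z' \<noteq> 0" by (simp_all add: z_def z'_def)
  have BB: "B * B' \<in> carrier_mat m m" using assms by (rule mult_carrier_mat)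
  show "proj l B * proj l B' = proj l (B * B')"
    unfolding proj_def Let_def z_def[symmetric] z'_def[symmetric] blk_mult[OF assms]
    using d by (intro blk_cong; simp add: divide_simps) (simp_all add: algebra_simps)
  show "proj l B * proj (flip l) B' = 0\<^sub>m (2 * m) (2 * m)"
    unfolding proj_def Let_def flip_flip z_def[symmetric] z'_def[symmetric] blk_mult[OF assms] blk_zero[OF BB, symmetric]
    using d by (intro blk_cong) (simp_all add: divide_simps)
qed

lemma proj_add_flip: "proj l (1\<^sub>m m) + proj (flip l) (1\<^sub>m m) = 1\<^sub>m (2 * m)"
proof -
  define z z' :: 'a where "z = slope l" and "z' = slope (flip l)"
  have d: "z' - z \<noteq> 0" "z - z' \<noteq> 0" by (simp_all add: z_def z'_def)
  show ?thesis
    unfolding proj_def Let_def flip_flip z_def[symmetric] z'_def[symmetric] using d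
    by (intro eq_matI) (auto simp: blk_def divide_simps, simp_all add: algebra_simps)
qed

text \<open>
  The first column of a product of rank one projections is a multiple of \<open>(1, slope l)\<close> for the
  first letter \<open>l\<close>. That of the empty product is \<open>(1, 0)\<close>, and \<open>0\<close> is not the slope of a letter.
\<close>

definition tail_slope :: "letter list \<Rightarrow> 'a::field_char_0" where
  "tail_slope w = (if w = [] then 0 else slope (hd w))"

text \<open>Projecting \<open>(1, t)\<close> onto the line of slope \<open>z\<close> along that of
  slope \<open>z'\<close> gives \<open>(z' - t) / (z' - z)\<close> times \<open>(1, z)\<close>;
  these factors accumulate along the word.\<close>

primrec proj_coeff :: "letter list \<Rightarrow> 'a::field_char_0" where
  "proj_coeff [] = 1"
| "proj_coeff (l # w) =
    proj_coeff w * (slope (flip l) - tail_slope w) / (slope (flip l) - slope l)"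

text \<open>A factor vanishes only if the next letter is \<open>flip l\<close>, which reducedness
  forbids.\<close>

lemma proj_coeff_nonzero: "reduced w \<Longrightarrow> proj_coeff w \<noteq> 0"
  by (induction w) (auto simp: reduced_Cons tail_slope_def)

lemma wprod_proj:
  assumes N: "\<And>l. N l \<in> carrier_mat m m"
  shows "\<exists>X Y. X \<in> carrier_mat m m \<and> Y \<in> carrier_mat m m \<and>
    wprod (2 * m) (\<lambda>l. proj l (N l)) w =
    four_block_mat (proj_coeff w \<cdot>\<^sub>m wprod m N w) X
      ((proj_coeff w * tail_slope w) \<cdot>\<^sub>m wprod m N w) Y"
proof (induction w)
  case Nil
  show ?case
    by (rule exI[of _ "0\<^sub>m m m"], rule exI[of _ "1\<^sub>m m"]) (auto simp: tail_slope_def intro!: eq_matI)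
next
  case (Cons l w)
  define t :: 'a where "t = tail_slope w"
  define \<kappa> :: 'a where "\<kappa> = proj_coeff w"
  define z z' :: 'a where "z = slope l" and "z' = slope (flip l)"
  define d where "d = z' - z"
  obtain X Y where IH: "X \<in> carrier_mat m m" "Y \<in> carrier_mat m m"
    "wprod (2 * m) (\<lambda>l. proj l (N l)) w =
      four_block_mat (\<kappa> \<cdot>\<^sub>m wprod m N w) X ((\<kappa> * t) \<cdot>\<^sub>m wprod m N w) Y"
    using Cons unfolding t_def \<kappa>_def by blast
  have V: "wprod m N w \<in> carrier_mat m m" using N by simp
  have NV: "N l * wprod m N w \<in> carrier_mat m m" using N V by (rule mult_carrier_mat)
  have d: "d \<noteq> 0" by (simp add: d_def z_def z'_def)
  have c: "x \<cdot>\<^sub>m N l \<in> carrier_mat m m" "x \<cdot>\<^sub>m wprod m N w \<in> carrier_mat m m" for x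
    using N V by auto
  have sm: "(x \<cdot>\<^sub>m N l) * (y \<cdot>\<^sub>m wprod m N w) = (x * y) \<cdot>\<^sub>m (N l * wprod m N w)" for x y
    using N[of l] V by (intro eq_matI) (auto simp: scalar_prod_def sum_distrib_left mult_ac)
  let ?\<kappa> = "\<kappa> * (z' - t) / d"
  let ?X = "(z' / d) \<cdot>\<^sub>m N l * X + (- 1 / d) \<cdot>\<^sub>m N l * Y"
  let ?Y = "(z * z' / d) \<cdot>\<^sub>m N l * X + (- z / d) \<cdot>\<^sub>m N l * Y"
  have P: "proj l (N l) = four_block_mat ((z' / d) \<cdot>\<^sub>m N l) ((- 1 / d) \<cdot>\<^sub>m N l)
      ((z * z' / d) \<cdot>\<^sub>m N l) ((- z / d) \<cdot>\<^sub>m N l)"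
    unfolding proj_def Let_def z_def z'_def d_def blk_def ..
  have "wprod (2 * m) (\<lambda>l. proj l (N l)) (l # w) = four_block_mat
      ((z' / d * \<kappa> + - 1 / d * (\<kappa> * t)) \<cdot>\<^sub>m (N l * wprod m N w)) ?X
      ((z * z' / d * \<kappa> + - z / d * (\<kappa> * t)) \<cdot>\<^sub>m (N l * wprod m N w)) ?Y"
    unfolding wprod_simps IH(3) P
    by (subst mult_four_block_mat[OF c(1) c(1) c(1) c(1) c(2) IH(1) c(2) IH(2)])
       (simp only: sm add_smult_distrib_right_mat[OF NV])
  also have "z' / d * \<kappa> + - 1 / d * (\<kappa> * t) = ?\<kappa>"
    using d by (simp add: field_simps)
  also have "z * z' / d * \<kappa> + - z / d * (\<kappa> * t) = ?\<kappa> * z"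
    using d by (simp add: field_simps)
  finally have eq: "wprod (2 * m) (\<lambda>l. proj l (N l)) (l # w) =
      four_block_mat (?\<kappa> \<cdot>\<^sub>m wprod m N (l # w)) ?X ((?\<kappa> * z) \<cdot>\<^sub>m wprod m N (l # w)) ?Y"
    unfolding wprod_simps .
  show ?case
  proof (intro exI conjI)
    show "?X \<in> carrier_mat m m" "?Y \<in> carrier_mat m m"
      using c(1) IH(1,2) by (auto intro!: add_carrier_mat mult_carrier_mat)
    show "wprod (2 * m) (\<lambda>l. proj l (N l)) (l # w) =
      four_block_mat (proj_coeff (l # w) \<cdot>\<^sub>m wprod m N (l # w)) ?X
        ((proj_coeff (l # w) * tail_slope (l # w)) \<cdot>\<^sub>m wprod m N (l # w)) ?Y"
      using eq by (simp add: tail_slope_def t_def \<kappa>_def z_def z'_def d_def)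
  qed
qed

section \<open>Mutually inverse matrices for the letters and their inverses\<close>

text \<open>This is \<open>u A\<^sub>l\<close> for \<open>u = 1 / t\<close>, which is polynomial in \<open>u\<close>.\<close>

definition group_mat :: "(letter \<Rightarrow> 'a mat) \<Rightarrow> (letter \<Rightarrow> 'a mat) \<Rightarrow> 'a \<Rightarrow> letter \<Rightarrow> 'a::field_char_0 mat" where
  "group_mat N N' u l = proj l (N l) + proj (flip l) (u\<^sup>2 \<cdot>\<^sub>m N' (flip l))"

lemma group_mat_carrier:
  assumes "\<And>l. N l \<in> carrier_mat m m" "\<And>l. N' l \<in> carrier_mat m m"
  shows "group_mat N N' u l \<in> carrier_mat (2 * m) (2 * m)"
  unfolding group_mat_def using assms by (intro add_carrier_mat proj_carrier) simp

lemma group_mat_zero: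
  assumes "\<And>l. N l \<in> carrier_mat m m" "\<And>l. N' l \<in> carrier_mat m m"
  shows "group_mat N N' 0 l = proj l (N l)"
proof -
  have "proj (flip l) (0\<^sup>2 \<cdot>\<^sub>m N' (flip l)) = 0\<^sub>m (2 * m) (2 * m)"
    using assms(2)[of "flip l"] by (intro eq_matI) (auto simp: proj_def blk_def Let_def)
  then show ?thesis
    using assms(1)[of l] unfolding group_mat_def
    by (metis proj_carrier right_add_zero_mat)
qed

lemma polyfun_group_mat:
  assumes "\<And>l. N l \<in> carrier_mat m m" "\<And>l. N' l \<in> carrier_mat m m" "i < 2 * m" "j < 2 * m"
  shows "polyfun (\<lambda>u. group_mat N N' u l $$ (i, j))"
  unfolding group_mat_def proj_def Let_def using assms by (intro polyfun_blk) auto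

text \<open>Products of complementary projections vanish. In the two remaining products
  \<open>N\<close> meets its inverse \<open>N'\<close>, which leaves \<open>u\<^sup>2\<close> times
  the sum of the two projections, that is, times the identity.\<close>

lemma group_mat_mult_flip:
  assumes N: "\<And>l. N l \<in> carrier_mat m m" and N': "\<And>l. N' l \<in> carrier_mat m m"
    and inverse: "\<And>l. N l * N' l = 1\<^sub>m m" "\<And>l. N' l * N l = 1\<^sub>m m"
  shows "group_mat N N' u l * group_mat N N' u (flip l) = u\<^sup>2 \<cdot>\<^sub>m 1\<^sub>m (2 * m)"
proof -
  let ?P = "proj l (N l)" and ?Q = "proj (flip l) (u\<^sup>2 \<cdot>\<^sub>m N' (flip l))"
  let ?R = "proj (flip l) (N (flip l))" and ?S = "proj l (u\<^sup>2 \<cdot>\<^sub>m N' l)"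
  have c: "u\<^sup>2 \<cdot>\<^sub>m N' l' \<in> carrier_mat m m" for l' using N' by simp
  note C = proj_carrier[OF N] proj_carrier[OF c]
  have s: "N l' * (u\<^sup>2 \<cdot>\<^sub>m N' l') = u\<^sup>2 \<cdot>\<^sub>m 1\<^sub>m m" "u\<^sup>2 \<cdot>\<^sub>m N' l' * N l' = u\<^sup>2 \<cdot>\<^sub>m 1\<^sub>m m" for l'
    using mult_smult_distrib[OF N N'] mult_smult_assoc_mat[OF N' N] inverse by metis+
  have "(?P + ?Q) * (?R + ?S) = ?P * (?R + ?S) + ?Q * (?R + ?S)"
    by (rule add_mult_distrib_mat[OF C(1) C(2) add_carrier_mat[OF C(2)]])
  also have "?P * (?R + ?S) = ?P * ?R + ?P * ?S"
    by (rule mult_add_distrib_mat[OF C(1) C(1) C(2)])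
  also have "?Q * (?R + ?S) = ?Q * ?R + ?Q * ?S"
    by (rule mult_add_distrib_mat[OF C(2) C(1) C(2)])
  also have "?P * ?R = 0\<^sub>m (2 * m) (2 * m)" by (rule proj_mult(2)[OF N N])
  also have "?P * ?S = proj l (u\<^sup>2 \<cdot>\<^sub>m 1\<^sub>m m)" by (simp only: proj_mult(1)[OF N c] s)
  also have "?Q * ?R = proj (flip l) (u\<^sup>2 \<cdot>\<^sub>m 1\<^sub>m m)" by (simp only: proj_mult(1)[OF c N] s)
  also have "?Q * ?S = 0\<^sub>m (2 * m) (2 * m)"
    using proj_mult(2)[OF c c, of "flip l" "flip l" l] by simp
  also have "(0\<^sub>m (2 * m) (2 * m) + proj l (u\<^sup>2 \<cdot>\<^sub>m 1\<^sub>m m)) +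
      (proj (flip l) (u\<^sup>2 \<cdot>\<^sub>m 1\<^sub>m m) + 0\<^sub>m (2 * m) (2 * m)) =
      u\<^sup>2 \<cdot>\<^sub>m (proj l (1\<^sub>m m) + proj (flip l) (1\<^sub>m m))"
    by (intro eq_matI) (auto simp: proj_def blk_def Let_def algebra_simps)
  finally show ?thesis
    unfolding group_mat_def flip_flip proj_add_flip .
qed

section \<open>Evaluation in the matrix algebra\<close>

lemma monoid_module_mat: "monoid (module_mat TYPE('a::comm_ring_1) k k)"
  by unfold_locales (auto simp: module_mat_simps intro: assoc_mult_mat mult_carrier_mat)

lemma index_finsum_module_mat:
  assumes "\<And>x. x \<in> A \<Longrightarrow> f x \<in> carrier_mat r c" "i < r" "j < c" "finite A"
  shows "finsum (module_mat TYPE('a::comm_ring_1) r c) f A $$ (i, j) = (\<Sum>x\<in>A. f x $$ (i, j))"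
proof -
  interpret abelian_group "module_mat TYPE('a) r c" by (rule abelian_group_mat)
  show ?thesis
    using assms(4,1)
  proof (induction A rule: finite_induct)
    case empty
    then show ?case using assms(2,3) by (simp add: module_mat_simps)
  next
    case (insert x A)
    have "finsum (module_mat TYPE('a) r c) f A \<in> carrier_mat r c"
      using insert.prems finsum_closed[of f A] by (auto simp: module_mat_simps)
    then show ?case
      using insert assms(2,3) by (subst finsum_insert) (auto simp: module_mat_simps)
  qed
qed

text \<open>The second assumption, applied to \<open>l\<close> and to \<open>flip l\<close>, makes
  \<open>B (flip l)\<close> a two-sided inverse of \<open>B l\<close>.\<close>

lemma letter_eval_inverse:
  fixes B :: "letter \<Rightarrow> 'a::field mat"
  assumes "\<And>l. B l \<in> carrier_mat k k" "\<And>l. B l * B (flip l) = 1\<^sub>m k"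
  shows "letter_eval (module_mat TYPE('a) k k) (\<lambda>i. B (i, True)) l = B l"
    and "B l \<in> Units (module_mat TYPE('a) k k)"
proof -
  interpret monoid "module_mat TYPE('a) k k" by (rule monoid_module_mat)
  have "B (i, True) * B (i, False) = 1\<^sub>m k" "B (i, False) * B (i, True) = 1\<^sub>m k" for i
    using assms(2)[of "(i, True)"] assms(2)[of "(i, False)"] by (simp_all add: flip_def)
  then have "inv\<^bsub>module_mat TYPE('a) k k\<^esub> B (i, True) = B (i, False)" for i
    using inv_unique'[of "B (i, True)" "B (i, False)"] assms(1) by (simp add: module_mat_simps)
  then show "letter_eval (module_mat TYPE('a) k k) (\<lambda>i. B (i, True)) l = B l"
    by (cases l) (simp add: letter_eval_def)
  show "B l \<in> Units (module_mat TYPE('a) k k)"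
    using assms(1)[of l] assms(1)[of "flip l"] assms(2)[of l] assms(2)[of "flip l"]
    by (auto simp: Units_def module_mat_simps)
qed

lemma not_identity_matrix_algebra:
  fixes f :: "letter list \<Rightarrow>\<^sub>0 'a::field_char_0"
  assumes "f \<in> free_group_algebra n" "f \<noteq> 0" "sparsity f < 2 ^ m"
  shows "\<not> is_identity n f (matrix_algebra TYPE('a) (2 * m))"
proof -
  let ?K = "Poly_Mapping.keys f" and ?c = "Poly_Mapping.lookup f"
  let ?A = "module_mat TYPE('a) (2 * m) (2 * m)"
  define D where "D = fga_degree f"
  let ?W = "{w \<in> ?K. length w = D}"
  have K: "finite ?K" "?K \<noteq> {}" using assms(2) by auto
  have D: "length w \<le> D" if "w \<in> ?K" for w
    using that K unfolding D_def fga_degree_def by simp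
  have "D \<in> length ` ?K"
    unfolding D_def fga_degree_def using K by (intro Max_in) auto
  then have W: "?W \<noteq> {}" by auto
  have red: "reduced w" if "w \<in> ?K" for w
    using assms(1) that by (auto simp: free_group_algebra_def reduced_words_def)
  have "card ?W \<le> card ?K" using K by (intro card_mono) auto
  then have card: "card ?W < 2 ^ m"
    using assms(3) by (simp add: sparsity_def)
  \<comment> \<open>The projections multiply the coefficient of \<open>w\<close> by
    \<open>proj_coeff w\<close>, so this scalar is absorbed before \<open>N\<close> is chosen; it is
    nonzero as \<open>w\<close> is reduced.\<close>
  have "\<exists>N. detects m N ?W (\<lambda>w. ?c w * proj_coeff w)"
  proof (rule detects_exists)
    show "?c w * proj_coeff w \<noteq> 0" if "w \<in> ?W" for w
      using that proj_coeff_nonzero[where 'a = 'a, OF red] by (simp add: in_keys_iff)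
    show "length w = D" if "w \<in> ?W" for w using that by simp
  qed (use K W card in simp_all)
  then obtain N i j where N: "\<And>l. N l \<in> carrier_mat m m" "\<And>l. det (N l) \<noteq> 0"
    and ij: "i < m" "j < m" "(\<Sum>w\<in>?W. ?c w * proj_coeff w * wprod m N w $$ (i, j)) \<noteq> 0"
    unfolding detects_def by blast
  obtain N' where N': "\<And>l. N' l \<in> carrier_mat m m"
      "\<And>l. N l * N' l = 1\<^sub>m m" "\<And>l. N' l * N l = 1\<^sub>m m"
    using det_nonzero_inverse[OF N] by metis
  let ?G = "group_mat N N'"
  \<comment> \<open>For nonzero \<open>u\<close> this is \<open>u ^ D\<close> times an entry of the
    value of \<open>f\<close> at the matrices \<open>group_mat\<close> divided by \<open>u\<close>;
    the power of \<open>u\<close> clears all denominators.\<close>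
  define \<phi> where "\<phi> u = (\<Sum>w\<in>?K. ?c w * u ^ (D - length w) * wprod (2 * m) (?G u) w $$ (i, j))" for u
  have "polyfun \<phi>"
    unfolding \<phi>_def using ij(1,2)
    by (intro polyfun_sum polyfun_mult polyfun_const polyfun_power polyfun_id polyfun_wprod
        group_mat_carrier polyfun_group_mat N(1) N'(1)) (use N(1) N'(1) in simp_all)
  moreover have "\<phi> 0 = (\<Sum>w\<in>?W. ?c w * proj_coeff w * wprod m N w $$ (i, j))"
  proof -
    have "wprod (2 * m) (?G 0) w $$ (i, j) = proj_coeff w * wprod m N w $$ (i, j)" for w
    proof -
      have "?G 0 = (\<lambda>l. proj l (N l))"
        by (intro ext group_mat_zero[where m = m] N(1) N'(1))
      moreover obtain X Y where XY: "X \<in> carrier_mat m m" "Y \<in> carrier_mat m m"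
        "wprod (2 * m) (\<lambda>l. proj l (N l)) w =
          four_block_mat (proj_coeff w \<cdot>\<^sub>m wprod m N w) X
            ((proj_coeff w * tail_slope w) \<cdot>\<^sub>m wprod m N w) Y"
        using wprod_proj[of N m w, OF N(1)] by blast
      moreover have "wprod m N w \<in> carrier_mat m m" using N(1) by simp
      ultimately show ?thesis using ij(1,2) by simp
    qed
    \<comment> \<open>The factor \<open>0 ^ (D - length w)\<close> is \<open>1\<close> for the
      longest words and \<open>0\<close> for all shorter ones.\<close>
    then have "\<phi> 0 = (\<Sum>w\<in>?K. if length w = D then ?c w * proj_coeff w * wprod m N w $$ (i, j) else 0)"
      unfolding \<phi>_def using D by (intro sum.cong) (auto simp: power_0_left dest: le_antisym)
    then show ?thesis
      using K(1) by (simp add: sum.inter_filter)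
  qed
  ultimately obtain u where u: "u \<noteq> 0" "\<phi> u \<noteq> 0"
    using polyfun_nonzero_shift ij(3) by metis
  have G: "?G u l \<in> carrier_mat (2 * m) (2 * m)" for l
    by (intro group_mat_carrier N(1) N'(1))
  \<comment> \<open>Dividing by \<open>u\<close> removes the factor \<open>u\<^sup>2\<close> from
    the product of opposite letters.\<close>
  define B where "B l = (1 / u) \<cdot>\<^sub>m ?G u l" for l
  have B: "B l \<in> carrier_mat (2 * m) (2 * m)" for l
    unfolding B_def using G by simp
  have "B l * B (flip l) = 1\<^sub>m (2 * m)" for l
  proof -
    have "B l * B (flip l) = (1 / u * (1 / u)) \<cdot>\<^sub>m (?G u l * ?G u (flip l))"
      using G[of l] G[of "flip l"] unfolding B_def
      by (intro eq_matI) (auto simp: scalar_prod_def sum_distrib_left mult_ac)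
    also have "\<dots> = 1\<^sub>m (2 * m)"
      unfolding group_mat_mult_flip[of N m N', OF N(1) N'] using u(1)
      by (intro eq_matI) (auto simp: power2_eq_square)
    finally show ?thesis .
  qed
  note eval = letter_eval_inverse[where B = B, OF B this]
  let ?a = "\<lambda>i. B (i, True)"
  have word: "word_eval ?A ?a w = (1 / u) ^ length w \<cdot>\<^sub>m wprod (2 * m) (?G u) w" for w
  proof -
    have "word_eval ?A ?a w = wprod (2 * m) B w"
      unfolding word_eval_def wprod_def eval(1) by (simp add: module_mat_simps)
    then show ?thesis
      using wprod_smult[where M = "?G u" and c = "1 / u", OF G] by (simp add: B_def[abs_def])
  qed
  have GW: "wprod (2 * m) (?G u) w \<in> carrier_mat (2 * m) (2 * m)" for w
    using G by simp
  have "fga_eval ?A ?a f $$ (i, j) = (\<Sum>w\<in>?K. (?c w \<cdot>\<^sub>m word_eval ?A ?a w) $$ (i, j))"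
    unfolding fga_eval_def module_mat_simps using ij(1,2) K(1) GW
    by (subst index_finsum_module_mat) (auto simp: word)
  also have "\<dots> = (\<Sum>w\<in>?K. (1 / u) ^ D *
      (?c w * u ^ (D - length w) * wprod (2 * m) (?G u) w $$ (i, j)))"
  proof (intro sum.cong refl)
    fix w assume "w \<in> ?K"
    then have pow: "(1 / u) ^ length w = (1 / u) ^ D * u ^ (D - length w)"
      using u(1) D by (simp add: power_diff power_one_over field_simps)
    have "(?c w \<cdot>\<^sub>m word_eval ?A ?a w) $$ (i, j) =
        ?c w * ((1 / u) ^ length w * wprod (2 * m) (?G u) w $$ (i, j))"
      using GW[of w] ij(1,2) by (simp add: word del: power_one_over)
    then show "(?c w \<cdot>\<^sub>m word_eval ?A ?a w) $$ (i, j) =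
        (1 / u) ^ D * (?c w * u ^ (D - length w) * wprod (2 * m) (?G u) w $$ (i, j))"
      unfolding pow by (simp only: mult_ac)
  qed
  also have "\<dots> = (1 / u) ^ D * \<phi> u"
    by (simp only: \<phi>_def sum_distrib_left)
  finally have "fga_eval ?A ?a f $$ (i, j) \<noteq> 0" using u by simp
  then have "fga_eval ?A ?a f \<noteq> \<zero>\<^bsub>?A\<^esub>"
    using ij(1,2) by (auto simp: module_mat_simps)
  moreover have "\<forall>i<n. ?a i \<in> Units ?A" using eval(2) by simp
  ultimately show ?thesis
    unfolding is_identity_def not_all not_imp by (intro exI[of _ ?a] conjI)
qed

theorem theorem3:
  shows "\<exists>K :: nat \<Rightarrow> nat.
    (\<lambda>s. real (K s)) \<in> O(\<lambda>s. ln (real s)) \<and>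
    (\<forall>n D s. \<forall>f :: letter list \<Rightarrow>\<^sub>0 'a::field_char_0.
      f \<in> free_group_algebra n \<and> f \<noteq> 0 \<and> fga_degree f = D \<and> sparsity f = s \<longrightarrow>
        \<not> is_identity n f (matrix_algebra TYPE('a) (K s)))"
proof (intro exI[of _ "\<lambda>s. 2 * floorlog 2 s"] conjI allI impI)
  show "(\<lambda>s. real (2 * floorlog 2 s)) \<in> O(\<lambda>s. ln (real s))"
  \<comment> \<open>For \<open>s \<ge> 2\<close> the bound \<open>1 \<le> log 2 s\<close> absorbs
    the additive one: \<open>2 * (log 2 s + 1) \<le> 4 * log 2 s\<close>.\<close>
  proof (rule bigoI[where c = "4 / ln 2"])
    show "\<forall>\<^sub>F s in sequentially. norm (real (2 * floorlog 2 s)) \<le> 4 / ln 2 * norm (ln (real s))"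
    proof (rule eventually_sequentiallyI[of 2])
      fix s :: nat assume s: "2 \<le> s"
      then have "1 \<le> log 2 s" by simp
      moreover have "real (floorlog 2 s) \<le> log 2 s + 1"
        using s by (simp add: floorlog_def)
      ultimately have "real (2 * floorlog 2 s) \<le> 4 * log 2 s" by simp
      then show "norm (real (2 * floorlog 2 s)) \<le> 4 / ln 2 * norm (ln (real s))"
        using s by (simp add: log_def)
    qed
  qed
next
  fix n D s and f :: "letter list \<Rightarrow>\<^sub>0 'a"
  assume "f \<in> free_group_algebra n \<and> f \<noteq> 0 \<and> fga_degree f = D \<and> sparsity f = s"
  \<comment> \<open>\<open>floorlog 2 s\<close> is the number of binary digits of a positive
    \<open>s\<close>, so \<open>s < 2 ^ floorlog 2 s\<close>; the factor \<open>2\<close> in the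
    dimension comes from the plane of the projections.\<close>
  moreover from this have "0 < s" by (auto simp: sparsity_def card_gt_0_iff)
  ultimately show "\<not> is_identity n f (matrix_algebra TYPE('a) (2 * floorlog 2 s))"
    using not_identity_matrix_algebra[of f n "floorlog 2 s"] floorlog_bounds[of s 2] by simp
qed

end
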